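(* Let $\mathbf{Ext}(\mathcal S)$ denote the lattice of axiomatic extensions of a logic $\mathcal S$. Then (a) $|\mathbf{Ext}(\mathcal{RDPCH})| = 2^{\aleph_0}$; (b) $|\mathbf{Ext}(\mathcal{RPCH}^d)| = 2^{\aleph_0}$; (c) $|\mathbf{Ext}(\mathcal{RDMH})| = 2^{\aleph_0}$.
   Context: Formulas are built from a countably infinite set of propositional variables in the language $\langle \vee,\wedge,\to,\sim,\bot,\top\rangle$ (with $\leftarrow$ in place of $\to$ for $\mathcal{RPCH}^d$). Abbreviations: $\alpha\to_H\beta:=\alpha\to(\alpha\wedge\beta)$; $\alpha\leftrightarrow_H\beta:=(\alpha\to_H\beta)\wedge(\beta\to_H\alpha)$; $\beta^*:=\beta\to\bot$. A Hilbert-style logic is the consequence relation $\Gamma\vdash\varphi$ given by finite derivations using elements of $\Gamma$, substitution instances of axioms, and instances of the rules. An axiomatic extension of a logic $\mathcal S$ is a logic obtained from $\mathcal S$ by adjoining a set of new axioms while keeping the rules of inference the same; extensions are identified when they have the same consequence relation. The logic $\mathcal{DHMSH}$ has axioms: (1) $\alpha\to_H(\alpha\vee\beta)$; (2) $\beta\to_H(\alpha\vee\beta)$; (3) $(\alpha\to_H\gamma)\to_H[(\beta\to_H\gamma)\to_H\{(\alpha\vee\beta)\to_H\gamma\}]$; (4) $(\alpha\wedge\beta)\to_H\alpha$; (5) $(\gamma\to_H\alpha)\to_H[(\gamma\to_H\beta)\to_H(\gamma\to_H(\alpha\wedge\beta))]$; (6) $\top$; (7) $\bot\to_H\alpha$;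 (8) $[(\alpha\wedge\beta)\to_H\gamma]\to_H[\alpha\to_H(\beta\to_H\gamma)]$; (9) $[\alpha\to_H(\beta\to_H\gamma)]\to_H[(\alpha\wedge\beta)\to_H\gamma]$; (10) $(\alpha\to_H\beta)\to_H[(\beta\to_H\alpha)\to_H((\alpha\to\gamma)\to_H(\beta\to\gamma))]$; (11) $(\alpha\to_H\beta)\to_H[(\beta\to_H\alpha)\to_H((\gamma\to\beta)\to_H(\gamma\to\alpha))]$; (12) $\top\to_H\sim\bot$; (13) $\sim\top\to_H\bot$; (14) $\sim(\alpha\wedge\beta)\to_H(\sim\alpha\vee\sim\beta)$; and rules (MP): from $\varphi$ and $\varphi\to_H\gamma$ deduce $\gamma$; (CP): from $\varphi\to_H\gamma$ deduce $\sim\gamma\to_H\sim\varphi$. $\mathcal{RDPCH}$ is the axiomatic extension of $\mathcal{DHMSH}$ by: (15) $(\alpha\wedge\beta)\to\alpha$; (16) $\sim\bot\to_H\top$; (17) $\sim\sim(\alpha\vee\beta)\leftrightarrow_H(\sim\sim\alpha\vee\sim\sim\beta)$; (18) $(\sim\sim\alpha\vee\alpha)\leftrightarrow_H\alpha$; (19) $\alpha\vee\sim\alpha$; ($\mathcal M_1$) $((\alpha\wedge\sim\alpha)\vee(\beta\vee\beta^* ))\leftrightarrow_H(\beta\vee\beta^* )$. $\mathcal{RPCH}^d$ is obtained by dualizing the axioms and rules of $\mathcal{RDPCH}$: in every axiom and rule (with abbreviations expanded) interchange $\vee$ and $\wedge$, interchange $\bot$ and $\top$, replace $\to$ by $\leftarrow$,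 and leave $\sim$ unchanged. $\mathcal{RDMH}$ is the axiomatic extension of $\mathcal{DHMSH}$ by (15), (20) $\sim\sim\alpha\leftrightarrow_H\alpha$, and ($\mathcal M_2$) $[\{\alpha\wedge\sim((\sim\alpha)^* )\}\vee(\beta\vee\beta^* )]\leftrightarrow_H(\beta\vee\beta^* )$. *)

theory Defs
  imports Main "HOL-Library.Equipollence"
begin

section \<open>Hilbert-style logics and their axiomatic extensions\<close>

text \<open>
  A Hilbert system over a formula type \<open>'f\<close> whose propositional variables are indexed by \<open>nat\<close>.
  Axioms and rules are single formulas, respectively pairs (premises, conclusion) of formulas;
  the schemas they stand for are recovered by applying \<open>inst \<sigma>\<close> for arbitrary \<open>\<sigma>\<close>.
\<close>

record 'f hilbert =
  inst   :: "(nat \<Rightarrow> 'f) \<Rightarrow> 'f \<Rightarrow> 'f"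
  axioms :: "'f set"
  rules  :: "('f list \<times> 'f) set"

inductive derives :: "'f hilbert \<Rightarrow> 'f set \<Rightarrow> 'f \<Rightarrow> bool"
  for S :: "'f hilbert" and \<Gamma> :: "'f set" where
  premise: "\<phi> \<in> \<Gamma> \<Longrightarrow> derives S \<Gamma> \<phi>"
| axiom: "\<phi> \<in> axioms S \<Longrightarrow> derives S \<Gamma> (inst S \<sigma> \<phi>)"
| rule: "(ps, c) \<in> rules S \<Longrightarrow> (\<forall>p \<in> set ps. derives S \<Gamma> (inst S \<sigma> p))
    \<Longrightarrow> derives S \<Gamma> (inst S \<sigma> c)"

definition extend :: "'f hilbert \<Rightarrow> 'f set \<Rightarrow> 'f hilbert" where
  "extend S E = S\<lparr>axioms := axioms S \<union> E\<rparr>"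

text \<open>
  Extensions are identified when they have the same consequence relation, so the elements of
  \<open>Ext S\<close> are consequence relations. The lattice order is inclusion, i.e. the pointwise
  order \<open>\<le>\<close> on \<open>'f set \<Rightarrow> 'f \<Rightarrow> bool\<close>.
\<close>

definition Ext :: "'f hilbert \<Rightarrow> ('f set \<Rightarrow> 'f \<Rightarrow> bool) set" where
  "Ext S = {derives (extend S E) | E. True}"


section \<open>The language with implication\<close>

datatype fm =
    Var nat
  | Or fm fm    (infixr \<open>\<^bold>\<or>\<close> 60)
  | And fm fm   (infixr \<open>\<^bold>\<and>\<close> 65)
  | Imp fm fm   (infixr \<open>\<^bold>\<rightarrow>\<close> 55)
  | Neg fm      (\<open>\<^bold>\<sim> _\<close> [70] 70)
  | Bot         (\<open>\<^bold>\<bottom>\<close>)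
  | Top         (\<open>\<^bold>\<top>\<close>)

primrec subst_fm :: "(nat \<Rightarrow> fm) \<Rightarrow> fm \<Rightarrow> fm" where
  "subst_fm \<sigma> (Var n) = \<sigma> n"
| "subst_fm \<sigma> (a \<^bold>\<or> b) = subst_fm \<sigma> a \<^bold>\<or> subst_fm \<sigma> b"
| "subst_fm \<sigma> (a \<^bold>\<and> b) = subst_fm \<sigma> a \<^bold>\<and> subst_fm \<sigma> b"
| "subst_fm \<sigma> (a \<^bold>\<rightarrow> b) = subst_fm \<sigma> a \<^bold>\<rightarrow> subst_fm \<sigma> b"
| "subst_fm \<sigma> (\<^bold>\<sim> a) = \<^bold>\<sim> subst_fm \<sigma> a"
| "subst_fm \<sigma> \<^bold>\<bottom> = \<^bold>\<bottom>"
| "subst_fm \<sigma> \<^bold>\<top> = \<^bold>\<top>"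

abbreviation ImpH :: "fm \<Rightarrow> fm \<Rightarrow> fm" (infixr \<open>\<^bold>\<rightarrow>\<^sub>H\<close> 55) where
  "a \<^bold>\<rightarrow>\<^sub>H b \<equiv> a \<^bold>\<rightarrow> (a \<^bold>\<and> b)"

abbreviation IffH :: "fm \<Rightarrow> fm \<Rightarrow> fm" (infix \<open>\<^bold>\<leftrightarrow>\<^sub>H\<close> 54) where
  "a \<^bold>\<leftrightarrow>\<^sub>H b \<equiv> (a \<^bold>\<rightarrow>\<^sub>H b) \<^bold>\<and> (b \<^bold>\<rightarrow>\<^sub>H a)"

abbreviation Star :: "fm \<Rightarrow> fm" (\<open>_\<^sup>\<star>\<close> [1000] 1000) where
  "b\<^sup>\<star> \<equiv> b \<^bold>\<rightarrow> \<^bold>\<bottom>"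


section \<open>The logics DHMSH, RDPCH and RDMH\<close>

definition DHMSH :: "fm hilbert" where
  "DHMSH = (let \<alpha> = Var 0; \<beta> = Var 1; \<gamma> = Var 2 in
    \<lparr> inst = subst_fm,
      axioms = {
        \<alpha> \<^bold>\<rightarrow>\<^sub>H (\<alpha> \<^bold>\<or> \<beta>),
        \<beta> \<^bold>\<rightarrow>\<^sub>H (\<alpha> \<^bold>\<or> \<beta>),
        (\<alpha> \<^bold>\<rightarrow>\<^sub>H \<gamma>) \<^bold>\<rightarrow>\<^sub>H ((\<beta> \<^bold>\<rightarrow>\<^sub>H \<gamma>) \<^bold>\<rightarrow>\<^sub>H ((\<alpha> \<^bold>\<or> \<beta>) \<^bold>\<rightarrow>\<^sub>H \<gamma>)),
        (\<alpha> \<^bold>\<and> \<beta>) \<^bold>\<rightarrow>\<^sub>H \<alpha>,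
        (\<gamma> \<^bold>\<rightarrow>\<^sub>H \<alpha>) \<^bold>\<rightarrow>\<^sub>H ((\<gamma> \<^bold>\<rightarrow>\<^sub>H \<beta>) \<^bold>\<rightarrow>\<^sub>H (\<gamma> \<^bold>\<rightarrow>\<^sub>H (\<alpha> \<^bold>\<and> \<beta>))),
        \<^bold>\<top>,
        \<^bold>\<bottom> \<^bold>\<rightarrow>\<^sub>H \<alpha>,
        ((\<alpha> \<^bold>\<and> \<beta>) \<^bold>\<rightarrow>\<^sub>H \<gamma>) \<^bold>\<rightarrow>\<^sub>H (\<alpha> \<^bold>\<rightarrow>\<^sub>H (\<beta> \<^bold>\<rightarrow>\<^sub>H \<gamma>)),
        (\<alpha> \<^bold>\<rightarrow>\<^sub>H (\<beta> \<^bold>\<rightarrow>\<^sub>H \<gamma>)) \<^bold>\<rightarrow>\<^sub>H ((\<alpha> \<^bold>\<and> \<beta>) \<^bold>\<rightarrow>\<^sub>H \<gamma>),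
        (\<alpha> \<^bold>\<rightarrow>\<^sub>H \<beta>) \<^bold>\<rightarrow>\<^sub>H ((\<beta> \<^bold>\<rightarrow>\<^sub>H \<alpha>) \<^bold>\<rightarrow>\<^sub>H ((\<alpha> \<^bold>\<rightarrow> \<gamma>) \<^bold>\<rightarrow>\<^sub>H (\<beta> \<^bold>\<rightarrow> \<gamma>))),
        (\<alpha> \<^bold>\<rightarrow>\<^sub>H \<beta>) \<^bold>\<rightarrow>\<^sub>H ((\<beta> \<^bold>\<rightarrow>\<^sub>H \<alpha>) \<^bold>\<rightarrow>\<^sub>H ((\<gamma> \<^bold>\<rightarrow> \<beta>) \<^bold>\<rightarrow>\<^sub>H (\<gamma> \<^bold>\<rightarrow> \<alpha>))),
        \<^bold>\<top> \<^bold>\<rightarrow>\<^sub>H \<^bold>\<sim> \<^bold>\<bottom>,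
        \<^bold>\<sim> \<^bold>\<top> \<^bold>\<rightarrow>\<^sub>H \<^bold>\<bottom>,
        \<^bold>\<sim> (\<alpha> \<^bold>\<and> \<beta>) \<^bold>\<rightarrow>\<^sub>H (\<^bold>\<sim> \<alpha> \<^bold>\<or> \<^bold>\<sim> \<beta>) },
      rules = {
        ([\<alpha>, \<alpha> \<^bold>\<rightarrow>\<^sub>H \<beta>], \<beta>),
        ([\<alpha> \<^bold>\<rightarrow>\<^sub>H \<beta>], \<^bold>\<sim> \<beta> \<^bold>\<rightarrow>\<^sub>H \<^bold>\<sim> \<alpha>) } \<rparr>)"

definition RDPCH :: "fm hilbert" where
  "RDPCH = (let \<alpha> = Var 0; \<beta> = Var 1 in
    extend DHMSH {
      (\<alpha> \<^bold>\<and> \<beta>) \<^bold>\<rightarrow> \<alpha>,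
      \<^bold>\<sim> \<^bold>\<bottom> \<^bold>\<rightarrow>\<^sub>H \<^bold>\<top>,
      \<^bold>\<sim> \<^bold>\<sim> (\<alpha> \<^bold>\<or> \<beta>) \<^bold>\<leftrightarrow>\<^sub>H (\<^bold>\<sim> \<^bold>\<sim> \<alpha> \<^bold>\<or> \<^bold>\<sim> \<^bold>\<sim> \<beta>),
      (\<^bold>\<sim> \<^bold>\<sim> \<alpha> \<^bold>\<or> \<alpha>) \<^bold>\<leftrightarrow>\<^sub>H \<alpha>,
      \<alpha> \<^bold>\<or> \<^bold>\<sim> \<alpha>,
      ((\<alpha> \<^bold>\<and> \<^bold>\<sim> \<alpha>) \<^bold>\<or> (\<beta> \<^bold>\<or> \<beta>\<^sup>\<star>)) \<^bold>\<leftrightarrow>\<^sub>H (\<beta> \<^bold>\<or> \<beta>\<^sup>\<star>) })"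

definition RDMH :: "fm hilbert" where
  "RDMH = (let \<alpha> = Var 0; \<beta> = Var 1 in
    extend DHMSH {
      (\<alpha> \<^bold>\<and> \<beta>) \<^bold>\<rightarrow> \<alpha>,
      \<^bold>\<sim> \<^bold>\<sim> \<alpha> \<^bold>\<leftrightarrow>\<^sub>H \<alpha>,
      ((\<alpha> \<^bold>\<and> \<^bold>\<sim> ((\<^bold>\<sim> \<alpha>)\<^sup>\<star>)) \<^bold>\<or> (\<beta> \<^bold>\<or> \<beta>\<^sup>\<star>)) \<^bold>\<leftrightarrow>\<^sub>H (\<beta> \<^bold>\<or> \<beta>\<^sup>\<star>) })"


section \<open>The dual language and the dual logic RPCHd\<close>

text \<open>\<open>DImp a b\<close> is the formula \<open>a \<leftarrow> b\<close>.\<close>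

datatype dfm =
    DVar nat
  | DOr dfm dfm
  | DAnd dfm dfm
  | DImp dfm dfm
  | DNeg dfm
  | DBot
  | DTop

primrec subst_dfm :: "(nat \<Rightarrow> dfm) \<Rightarrow> dfm \<Rightarrow> dfm" where
  "subst_dfm \<sigma> (DVar n) = \<sigma> n"
| "subst_dfm \<sigma> (DOr a b) = DOr (subst_dfm \<sigma> a) (subst_dfm \<sigma> b)"
| "subst_dfm \<sigma> (DAnd a b) = DAnd (subst_dfm \<sigma> a) (subst_dfm \<sigma> b)"
| "subst_dfm \<sigma> (DImp a b) = DImp (subst_dfm \<sigma> a) (subst_dfm \<sigma> b)"
| "subst_dfm \<sigma> (DNeg a) = DNeg (subst_dfm \<sigma> a)"
| "subst_dfm \<sigma> DBot = DBot"
| "subst_dfm \<sigma> DTop = DTop"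

text \<open>
  Only the symbol \<open>\<rightarrow>\<close> is replaced, not the order of its arguments: in a dual Heyting algebra
  \<open>a \<leftarrow> b\<close> is the least \<open>c\<close> with \<open>b \<le> a \<or> c\<close>.
\<close>

primrec dual :: "fm \<Rightarrow> dfm" where
  "dual (Var n) = DVar n"
| "dual (a \<^bold>\<or> b) = DAnd (dual a) (dual b)"
| "dual (a \<^bold>\<and> b) = DOr (dual a) (dual b)"
| "dual (a \<^bold>\<rightarrow> b) = DImp (dual a) (dual b)"
| "dual (\<^bold>\<sim> a) = DNeg (dual a)"
| "dual \<^bold>\<bottom> = DTop"
| "dual \<^bold>\<top> = DBot"

definition RPCHd :: "dfm hilbert" where
  "RPCHd = \<lparr> inst = subst_dfm,
     axioms = dual ` axioms RDPCH,
     rules = map_prod (map dual) dual ` rules RDPCH \<rparr>"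

end

theory Submission
  imports Defs "HOL-Library.Countable"
begin

text \<open>
  The upper bound holds because there are countably many formulas. For the lower bound we use the
  upset algebras of the crowns: bottoms and tops are both indexed by \<open>i < m\<close>, and bottom \<open>i\<close> lies
  below top \<open>j\<close> iff \<open>i \<noteq> j\<close>. With the dual pseudocomplement they are models of \<open>RDPCH\<close>, with the
  involution exchanging the two levels models of \<open>RDMH\<close>. Crowns have bounded diameter, so for
  \<open>m \<ge> 3\<close> applying twice the map that sends \<open>a\<close> to the pseudocomplement of its dual
  pseudocomplement takes every element other than the greatest one to the least one. Hence a formula
  can say that no \<open>n\<close> nonzero elements are pairwise disjoint and have pseudocomplements with join
  \<open>1\<close>. The condition on the join means that each bottom lies below no top of some \<open>x\<^sub>i\<close>, so that each
  top is the only one in some \<open>x\<^sub>i\<close>; therefore this formula fails in the crown of size \<open>n\<close> and in no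
  other, and distinct sets of these formulas axiomatize distinct extensions. Undualizing derivations
  transfers this independence to \<open>RPCHd\<close>.
\<close>

section \<open>Counting axiomatic extensions\<close>

instance fm :: countable by countable_datatype

instance dfm :: countable by countable_datatype

lemma Ext_lepoll: "Ext (S :: 'f::countable hilbert) \<lesssim> (UNIV :: nat set set)"
proof -
  have "Ext S = range (\<lambda>E. derives (extend S E))"
    by (auto simp: Ext_def)
  moreover have "range (\<lambda>E. derives (extend S E)) \<lesssim> (UNIV :: 'f set set)"
    by (rule image_lepoll)
  moreover have "(UNIV :: 'f set set) \<lesssim> (UNIV :: nat set set)"
    unfolding lepoll_def
    by (intro exI[of _ "image to_nat"]) (auto simp: inj_on_def inj_image_eq_iff)
  ultimately show ?thesis
    by (metis lepoll_trans)
qed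

text \<open>The extension by the formulas with index in \<open>A\<close> derives \<open>f k\<close>
  exactly for \<open>k \<in> A\<close>, so it determines \<open>A\<close>. The identity substitution
  \<open>\<iota>\<close> recovers \<open>f k\<close> itself, as axioms enter derivations only as
  instances.\<close>

lemma Ext_eqpoll_if_independent:
  fixes S :: "'f::countable hilbert" and f :: "nat \<Rightarrow> 'f"
  assumes inst: "\<And>k. inst S \<iota> (f k) = f k"
    and indep: "\<And>k A. k \<notin> A \<Longrightarrow> \<not> derives (extend S (f ` A)) {} (f k)"
  shows "Ext S \<approx> (UNIV :: nat set set)"
proof (rule lepoll_antisym[OF Ext_lepoll])
  have "derives (extend S (f ` A)) {} (f k) \<longleftrightarrow> k \<in> A" for k A
    using derives.axiom[of "f k" "extend S (f ` A)" "{}" \<iota>] indep[of k A] inst[of k]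
    by (auto simp: extend_def)
  then have "inj (\<lambda>A. derives (extend S (f ` A)))"
    by (intro injI) (metis subsetI subset_antisym)
  then show "(UNIV :: nat set set) \<lesssim> Ext S"
    unfolding lepoll_def Ext_def by blast
qed

section \<open>Upset algebras\<close>

locale frame =
  fixes X :: "'w set" and le :: "'w \<Rightarrow> 'w \<Rightarrow> bool"
  assumes le_refl: "w \<in> X \<Longrightarrow> le w w"
    and le_trans: "u \<in> X \<Longrightarrow> v \<in> X \<Longrightarrow> w \<in> X \<Longrightarrow> le u v \<Longrightarrow> le v w \<Longrightarrow> le u w"
begin

definition upset :: "'w set \<Rightarrow> bool" where
  "upset U \<longleftrightarrow> U \<subseteq> X \<and> (\<forall>u\<in>U. \<forall>w\<in>X. le u w \<longrightarrow> w \<in> U)"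

definition imp :: "'w set \<Rightarrow> 'w set \<Rightarrow> 'w set" where
  "imp U V = {w \<in> X. \<forall>u\<in>X. le w u \<longrightarrow> u \<in> U \<longrightarrow> u \<in> V}"

text \<open>The upward closure of the complement: for an upset \<open>U\<close>, the least upset
  whose union with \<open>U\<close> is \<open>X\<close>.\<close>

definition dpc :: "'w set \<Rightarrow> 'w set" where
  "dpc U = {w \<in> X. \<exists>u\<in>X. le u w \<and> u \<notin> U}"

lemma upset_empty: "upset {}" and upset_X: "upset X"
  and upset_Un: "upset U \<Longrightarrow> upset V \<Longrightarrow> upset (U \<union> V)"
  and upset_Int: "upset U \<Longrightarrow> upset V \<Longrightarrow> upset (U \<inter> V)"
  by (auto simp: upset_def)

lemma upset_imp: "upset (imp U V)"
  unfolding upset_def imp_def by (blast intro: le_trans)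

lemma upset_dpc: "upset (dpc U)"
  unfolding upset_def dpc_def by (blast intro: le_trans)

lemma imp_eq_X_iff: "upset U \<Longrightarrow> imp U V = X \<longleftrightarrow> U \<subseteq> V"
  unfolding upset_def imp_def by (blast intro: le_refl)

text \<open>This makes \<open>ImpH\<close> and \<open>Imp\<close> evaluate alike.\<close>

lemma imp_Int_left: "imp U (U \<inter> V) = imp U V"
  unfolding imp_def by blast

lemma subset_imp_iff: "upset U \<Longrightarrow> U \<subseteq> imp V W \<longleftrightarrow> U \<inter> V \<subseteq> W"
  unfolding upset_def imp_def by (blast intro: le_refl)

lemma imp_mp: "w \<in> imp U V \<Longrightarrow> w \<in> U \<Longrightarrow> w \<in> V"
  unfolding imp_def by (blast intro: le_refl)

lemma mem_imp: "w \<in> imp U V \<longleftrightarrow> w \<in> X \<and> (\<forall>u\<in>X. le w u \<longrightarrow> u \<in> U \<longrightarrow> u \<in> V)"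
  by (simp add: imp_def)

end

text \<open>Keeping \<open>N\<close> abstract lets \<open>dpc\<close> and \<open>demorgan\<close>
  share one soundness proof. Antitonicity serves the rule (CP), the last three conditions serve the
  axioms on negation.\<close>

locale hemimorphic_frame = frame +
  fixes N :: "'a set \<Rightarrow> 'a set"
  assumes N_upset: "upset U \<Longrightarrow> upset (N U)"
    and N_antimono: "upset U \<Longrightarrow> upset V \<Longrightarrow> U \<subseteq> V \<Longrightarrow> N V \<subseteq> N U"
    and N_empty: "N {} = X"
    and N_X: "N X = {}"
    and N_Int: "upset U \<Longrightarrow> upset V \<Longrightarrow> N (U \<inter> V) \<subseteq> N U \<union> N V"
begin

primrec eval :: "(nat \<Rightarrow> 'a set) \<Rightarrow> fm \<Rightarrow> 'a set" where
  "eval v (Var n) = v n"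
| "eval v (a \<^bold>\<or> b) = eval v a \<union> eval v b"
| "eval v (a \<^bold>\<and> b) = eval v a \<inter> eval v b"
| "eval v (a \<^bold>\<rightarrow> b) = imp (eval v a) (eval v b)"
| "eval v (\<^bold>\<sim> a) = N (eval v a)"
| "eval v \<^bold>\<bottom> = {}"
| "eval v \<^bold>\<top> = X"

definition valid :: "fm \<Rightarrow> bool" where
  "valid \<phi> \<longleftrightarrow> (\<forall>v. (\<forall>n. upset (v n)) \<longrightarrow> eval v \<phi> = X)"

lemma upset_eval: "(\<And>n. upset (v n)) \<Longrightarrow> upset (eval v \<phi>)"
  by (induction \<phi>) (simp_all add: upset_Un upset_Int upset_imp N_upset upset_empty upset_X)

lemma eval_subst: "eval v (subst_fm \<sigma> \<phi>) = eval (\<lambda>n. eval v (\<sigma> n)) \<phi>"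
  by (induction \<phi>) simp_all

lemma valid_subst: "valid \<phi> \<Longrightarrow> valid (subst_fm \<sigma> \<phi>)"
  by (simp add: valid_def eval_subst upset_eval)

lemma eval_ImpH_eq_X_iff:
  "(\<And>n. upset (v n)) \<Longrightarrow> eval v (a \<^bold>\<rightarrow>\<^sub>H b) = X \<longleftrightarrow> eval v a \<subseteq> eval v b"
  by (simp add: imp_Int_left imp_eq_X_iff upset_eval)

lemma valid_ImpH_iff:
  "valid (a \<^bold>\<rightarrow>\<^sub>H b) \<longleftrightarrow> (\<forall>v. (\<forall>n. upset (v n)) \<longrightarrow> eval v a \<subseteq> eval v b)"
  unfolding valid_def using eval_ImpH_eq_X_iff by blast

lemma valid_And_iff: "valid (a \<^bold>\<and> b) \<longleftrightarrow> valid a \<and> valid b"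
proof -
  have "eval v a \<inter> eval v b = X \<longleftrightarrow> eval v a = X \<and> eval v b = X" if "\<forall>n. upset (v n)" for v
    using upset_eval[of v a] upset_eval[of v b] that by (auto simp: upset_def)
  then show ?thesis
    by (auto simp: valid_def)
qed

lemma valid_axioms_DHMSH:
  assumes "\<phi> \<in> axioms DHMSH"
  shows "valid \<phi>"
proof -
  have N_v: "N (v 0 \<inter> v 1) \<subseteq> N (v 0) \<union> N (v 1)" if "\<forall>n. upset (v n)" for v :: "nat \<Rightarrow> 'a set"
    using that N_Int by blast
  from assms show ?thesis
    unfolding DHMSH_def Let_def
    apply simp
    \<comment> \<open>The outermost \<open>ImpH\<close> becomes an inclusion; residuation
      (\<open>subset_imp_iff\<close>) unwinds the nested ones.\<close>
    apply (elim disjE; hypsubst; (subst valid_ImpH_iff)?)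
    apply (simp_all add: imp_Int_left N_empty N_X valid_def subset_imp_iff upset_imp upset_Int N_v[simplified])
    apply (use imp_mp in blast)+
    done
qed

lemma valid_if_derives:
  assumes "derives S {} \<phi>" "inst S = subst_fm" "rules S = rules DHMSH"
    and ax: "\<And>\<psi>. \<psi> \<in> axioms S \<Longrightarrow> valid \<psi>"
  shows "valid \<phi>"
  using assms(1)
proof (induction rule: derives.induct)
  case (premise \<phi>)
  then show ?case by simp
next
  case (axiom \<phi> \<sigma>)
  then show ?case by (simp add: assms(2) ax valid_subst)
next
  case (rule ps c \<sigma>)
  have prems: "valid (subst_fm \<sigma> p)" if "p \<in> set ps" for p
    using rule.IH that by (simp add: assms(2))
  have "(ps, c) \<in> rules DHMSH"
    using rule.hyps assms(3) by simp
  then consider (MP) "ps = [Var 0, Var 0 \<^bold>\<rightarrow>\<^sub>H Var 1]" "c = Var 1"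
    | (CP) "ps = [Var 0 \<^bold>\<rightarrow>\<^sub>H Var 1]" "c = \<^bold>\<sim> Var 1 \<^bold>\<rightarrow>\<^sub>H \<^bold>\<sim> Var 0"
    by (auto simp: DHMSH_def Let_def)
  then have "valid (subst_fm \<sigma> c)"
  proof cases
    case MP
    have "valid (\<sigma> 0)" "valid (\<sigma> 0 \<^bold>\<rightarrow>\<^sub>H \<sigma> 1)"
      using prems[of "Var 0"] prems[of "Var 0 \<^bold>\<rightarrow>\<^sub>H Var 1"] MP by simp_all
    then show ?thesis
      using upset_eval[of _ "\<sigma> 1"] unfolding valid_ImpH_iff
      by (simp add: valid_def MP upset_def) blast
  next
    case CP
    have "valid (\<sigma> 0 \<^bold>\<rightarrow>\<^sub>H \<sigma> 1)"
      using prems[of "Var 0 \<^bold>\<rightarrow>\<^sub>H Var 1"] CP by simp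
    then have "valid (\<^bold>\<sim> \<sigma> 1 \<^bold>\<rightarrow>\<^sub>H \<^bold>\<sim> \<sigma> 0)"
      unfolding valid_ImpH_iff by (simp add: N_antimono upset_eval)
    then show ?thesis
      by (simp add: CP)
  qed
  then show ?case
    by (simp add: assms(2))
qed

end

section \<open>Crowns\<close>

text \<open>The point \<open>(i, False)\<close> lies at the bottom, \<open>(i, True)\<close> at the top level.\<close>

definition crown_points :: "nat \<Rightarrow> (nat \<times> bool) set" where
  "crown_points m = {..<m} \<times> UNIV"

definition crown_le :: "nat \<times> bool \<Rightarrow> nat \<times> bool \<Rightarrow> bool" where
  "crown_le u w \<longleftrightarrow> u = w \<or> \<not> snd u \<and> snd w \<and> fst u \<noteq> fst w"

locale crown =
  fixes m :: nat
  assumes m_ge: "m \<ge> 3"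

sublocale crown \<subseteq> frame "crown_points m" crown_le
  by standard (auto simp: crown_le_def)

context crown
begin

abbreviation (input) "X \<equiv> crown_points m"

text \<open>By \<open>mem_box\<close>, the modal box of the relation that goes up and then down in
  the order.\<close>

definition box :: "(nat \<times> bool) set \<Rightarrow> (nat \<times> bool) set" where
  "box U = imp (dpc U) {}"

definition flip :: "nat \<times> bool \<Rightarrow> nat \<times> bool" where
  "flip w = (fst w, \<not> snd w)"

definition demorgan :: "(nat \<times> bool) set \<Rightarrow> (nat \<times> bool) set" where
  "demorgan U = {w \<in> X. flip w \<notin> U}"

text \<open>It gives any two bottoms a common top above them.\<close>

lemma ex_other: "\<exists>k<m. k \<noteq> i \<and> k \<noteq> j"
proof -
  have "0 \<noteq> i \<and> 0 \<noteq> j \<or> 1 \<noteq> i \<and> 1 \<noteq> j \<or> 2 \<noteq> i \<and> 2 \<noteq> j"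
    by auto
  moreover have "0 < m" "1 < m" "2 < m"
    using m_ge by auto
  ultimately show ?thesis
    by blast
qed

lemma top_mem_upset:
  assumes "upset U" "(i, False) \<in> U" "j < m" "i \<noteq> j"
  shows "(j, True) \<in> U"
proof -
  have "(j, True) \<in> X" "crown_le (i, False) (j, True)"
    using assms by (auto simp: crown_points_def crown_le_def)
  then show ?thesis
    using assms(1,2) unfolding upset_def by blast
qed

lemma mem_box:
  "w \<in> box U \<longleftrightarrow> w \<in> X \<and> (\<forall>u\<in>X. crown_le w u \<longrightarrow> (\<forall>t\<in>X. crown_le t u \<longrightarrow> t \<in> U))"
  by (auto simp: box_def mem_imp dpc_def)

text \<open>Going up and then down leads from a bottom to every bottom, through a common top, and
  from a top to the bottoms below it.\<close>

lemma bottom_mem_if_box: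
  assumes "(k, s) \<in> box U" "i < m" "i \<noteq> k \<or> \<not> s"
  shows "(i, False) \<in> U"
proof -
  obtain l where "l < m" "l \<noteq> k" "l \<noteq> i"
    using ex_other by blast
  then have "\<exists>u\<in>X. crown_le (k, s) u \<and> crown_le (i, False) u"
    using assms by (intro bexI[of _ "(if s then k else l, True)"])
      (auto simp: crown_points_def crown_le_def mem_box)
  then show ?thesis
    using assms(1,2) unfolding mem_box by (auto simp: crown_points_def)
qed

text \<open>From any point one round reaches some bottom \<open>l\<close>, and a second round
  reaches every bottom from there, including one that \<open>U\<close> misses.\<close>

lemma box_box:
  assumes "upset U"
  shows "box (box U) = (if U = X then X else {})"
proof (cases "U = X")
  case True
  then show ?thesis by (auto simp: mem_box)
next
  case False
  \<comment> \<open>If the missing point is a top, the bottoms below it are missing too.\<close>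
  obtain i where i: "i < m" "(i, False) \<notin> U"
  proof -
    have "U \<subseteq> X"
      using assms by (simp add: upset_def)
    then obtain j s where js: "j < m" "(j, s) \<notin> U"
      using False by (auto simp: crown_points_def)
    show thesis
    proof (cases s)
      case True
      obtain k where "k < m" "k \<noteq> j"
        using ex_other by blast
      then show thesis
        using js True that[of k] top_mem_upset[OF assms, of k j] by auto
    next
      case False
      then show thesis using js that by auto
    qed
  qed
  have "(k, s) \<notin> box (box U)" for k s
  proof
    assume box: "(k, s) \<in> box (box U)"
    obtain l where "l < m" "l \<noteq> k"
      using ex_other by blast
    then show False
      using bottom_mem_if_box[OF box, of l] bottom_mem_if_box[of l False U i] i by simp
  qed
  then show ?thesis
    using False by auto
qed

section \<open>Laws of the two negations on a crown\<close>

lemma flip_mem: "flip w \<in> X \<longleftrightarrow> w \<in> X"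
  by (auto simp: flip_def crown_points_def mem_Times_iff)

lemma flip_flip: "flip (flip w) = w"
  by (simp add: flip_def)

lemma crown_le_flip: "crown_le (flip u) (flip w) \<longleftrightarrow> crown_le w u"
  by (auto simp: flip_def crown_le_def prod_eq_iff)

lemma upset_demorgan: "upset U \<Longrightarrow> upset (demorgan U)"
  unfolding upset_def demorgan_def using crown_le_flip flip_mem by blast

lemma demorgan_demorgan: "upset U \<Longrightarrow> demorgan (demorgan U) = U"
  by (auto simp: upset_def demorgan_def flip_mem flip_flip)

text \<open>As \<open>flip\<close> reverses the order, conjugation by \<open>demorgan\<close> turns
  the pseudocomplement into its dual.\<close>

lemma demorgan_imp_demorgan: "upset U \<Longrightarrow> demorgan (imp (demorgan U) {}) = dpc U"
  unfolding demorgan_def imp_def dpc_def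
  using crown_le_flip flip_mem flip_flip by (auto; metis)

text \<open>The minimal points are the bottoms, so \<open>dpc (dpc U)\<close> consists of the points
  above a bottom in \<open>U\<close>; this existential condition distributes over unions.\<close>

lemma dpc_dpc_Un: "dpc (dpc (U \<union> V)) = dpc (dpc U) \<union> dpc (dpc V)"
proof -
  have *: "w \<in> dpc (dpc U) \<longleftrightarrow> w \<in> X \<and> (\<exists>u\<in>X. \<not> snd u \<and> crown_le u w \<and> u \<in> U)" for w U
  proof
    assume "w \<in> dpc (dpc U)"
    then obtain u where u: "w \<in> X" "u \<in> X" "crown_le u w" "\<And>t. t \<in> X \<Longrightarrow> crown_le t u \<Longrightarrow> t \<in> U"
      by (auto simp: dpc_def)
    obtain k where "k < m" "k \<noteq> fst u"
      using ex_other by blast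
    then have "\<exists>t\<in>X. \<not> snd t \<and> crown_le t u"
      using u(2) by (cases "snd u") (force simp: crown_points_def crown_le_def)+
    then show "w \<in> X \<and> (\<exists>u\<in>X. \<not> snd u \<and> crown_le u w \<and> u \<in> U)"
      using u le_trans by blast
  next
    assume "w \<in> X \<and> (\<exists>u\<in>X. \<not> snd u \<and> crown_le u w \<and> u \<in> U)"
    then show "w \<in> dpc (dpc U)"
      by (auto simp: dpc_def crown_le_def)
  qed
  show ?thesis
    unfolding set_eq_iff Un_iff * by blast
qed

lemma dpc_dpc_subset: "upset U \<Longrightarrow> dpc (dpc U) \<subseteq> U"
  unfolding dpc_def upset_def using le_refl by blast

text \<open>An element of \<open>U \<inter> dpc U\<close> is not minimal, hence it lies at the top level.\<close>

lemma regular: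
  assumes "upset U"
  shows "U \<inter> dpc U \<subseteq> V \<union> imp V {}"
proof
  fix w
  assume w: "w \<in> U \<inter> dpc U"
  then obtain u where "w \<in> X" "crown_le u w" "u \<notin> U"
    by (auto simp: dpc_def)
  with w have "snd w" "w \<in> X"
    by (auto simp: crown_le_def)
  then show "w \<in> V \<union> imp V {}"
    by (auto simp: mem_imp crown_le_def)
qed

end

sublocale crown \<subseteq> dp: hemimorphic_frame "crown_points m" crown_le dpc
  apply standard
  subgoal by (rule upset_dpc)
  subgoal by (auto simp: dpc_def)
  subgoal by (auto simp: dpc_def intro: le_refl)
  subgoal by (auto simp: dpc_def)
  subgoal by (auto simp: dpc_def)
  done

sublocale crown \<subseteq> dm: hemimorphic_frame "crown_points m" crown_le demorgan
  apply standard
  subgoal by (rule upset_demorgan)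
  subgoal by (auto simp: demorgan_def)
  subgoal by (auto simp: demorgan_def)
  subgoal by (auto simp: demorgan_def flip_mem)
  subgoal by (auto simp: demorgan_def)
  done

section \<open>Formulas refuted in exactly one crown\<close>

definition Disj :: "fm list \<Rightarrow> fm" where
  "Disj fs = foldr Or fs \<^bold>\<bottom>"

definition Conj :: "fm list \<Rightarrow> fm" where
  "Conj fs = foldr And fs \<^bold>\<top>"

text \<open>\<open>P\<close> stands for a formula operation that expresses the dual
  pseudocomplement.\<close>

definition Box :: "(fm \<Rightarrow> fm) \<Rightarrow> fm \<Rightarrow> fm" where
  "Box P \<phi> = (P \<phi>)\<^sup>\<star>"

text \<open>By \<open>box_box\<close> a doubled \<open>Box\<close> tests equality with
  \<open>X\<close>, with values \<open>X\<close> and \<open>{}\<close>. So the formula is a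
  classical implication: if the variables are pairwise disjoint and their pseudocomplements cover
  \<open>X\<close>, some variable is empty.\<close>

definition crown_fm :: "(fm \<Rightarrow> fm) \<Rightarrow> nat \<Rightarrow> fm" where
  "crown_fm P n =
    Box P (Box P (Disj (map (\<lambda>i. (Var i)\<^sup>\<star>) [0..<n])
      \<^bold>\<and> Conj (map (\<lambda>(i, j). (Var i \<^bold>\<and> Var j)\<^sup>\<star>) (filter (\<lambda>(i, j). i \<noteq> j) (List.product [0..<n] [0..<n])))))
    \<^bold>\<rightarrow> Disj (map (\<lambda>i. Box P (Box P ((Var i)\<^sup>\<star>))) [0..<n])"

context hemimorphic_frame
begin

lemma eval_Disj: "eval v (Disj fs) = (\<Union>f\<in>set fs. eval v f)"
  unfolding Disj_def by (induction fs) auto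

lemma eval_Conj: "eval v (Conj fs) = X \<inter> (\<Inter>f\<in>set fs. eval v f)"
  unfolding Conj_def by (induction fs) auto

end

context crown
begin

text \<open>Bottom \<open>j\<close> lies below every top but its own.\<close>

lemma eq_if_bottom_mem_imp_empty:
  assumes "(j, False) \<in> imp U {}" "(k, True) \<in> U" "k < m"
  shows "k = j"
proof (rule ccontr)
  assume "k \<noteq> j"
  then have "(k, True) \<in> X" "crown_le (j, False) (k, True)"
    using assms by (auto simp: crown_points_def crown_le_def)
  then show False
    using assms by (auto simp: mem_imp)
qed

lemma upset_has_top:
  assumes "upset U" "U \<noteq> {}"
  shows "\<exists>k<m. (k, True) \<in> U"
proof -
  have "U \<subseteq> X"
    using assms by (simp add: upset_def)
  then obtain i s where mem: "(i, s) \<in> U" "i < m"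
    using assms(2) by (auto simp: crown_points_def)
  obtain k where "k < m" "k \<noteq> i"
    using ex_other by blast
  then show ?thesis
    using mem top_mem_upset[OF assms(1), of i k] by (cases s) auto
qed

text \<open>Choose a top \<open>g i\<close> in each \<open>T i\<close>. Disjointness makes
  \<open>g\<close> injective; each bottom \<open>j\<close> lies in the pseudocomplement of some
  \<open>T i\<close>, which forces \<open>g i = j\<close>, so \<open>g\<close> is onto.\<close>

lemma crown_partition:
  assumes up: "\<And>i. i < n \<Longrightarrow> upset (T i)"
    and cover: "X \<subseteq> (\<Union>i<n. imp (T i) {})"
    and disj: "\<And>i j. i < n \<Longrightarrow> j < n \<Longrightarrow> i \<noteq> j \<Longrightarrow> T i \<inter> T j = {}"
    and nonempty: "\<And>i. i < n \<Longrightarrow> T i \<noteq> {}"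
  shows "n = m"
proof -
  have "\<forall>i. \<exists>k. i < n \<longrightarrow> k < m \<and> (k, True) \<in> T i"
    using upset_has_top up nonempty by blast
  then obtain g where g: "g i < m" "(g i, True) \<in> T i" if "i < n" for i
    by metis
  have "inj_on g {..<n}"
  proof (rule inj_onI)
    fix i j
    assume "i \<in> {..<n}" "j \<in> {..<n}" "g i = g j"
    then show "i = j"
      using g(2)[of i] g(2)[of j] disj[of i j] by auto
  qed
  then have "n \<le> m"
    using card_inj_on_le[of g "{..<n}" "{..<m}"] g by auto
  have "\<exists>i<n. (j, False) \<in> imp (T i) {}" if "j < m" for j
    using cover that by (auto simp: crown_points_def)
  then have "\<exists>i<n. g i = j" if "j < m" for j
    using that eq_if_bottom_mem_imp_empty g by blast
  then have "{..<m} \<subseteq> g ` {..<n}"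
    by auto
  then have "m \<le> n"
    using surj_card_le[of "{..<n}" "{..<m}" g] by auto
  with \<open>n \<le> m\<close> show ?thesis by simp
qed

lemma hemimorphic_crown_fm_valid_iff:
  assumes "hemimorphic_frame (crown_points m) crown_le N"
    and P: "\<And>v \<phi>. (\<And>n. upset (v n)) \<Longrightarrow>
      hemimorphic_frame.eval (crown_points m) crown_le N v (P \<phi>) =
      dpc (hemimorphic_frame.eval (crown_points m) crown_le N v \<phi>)"
  shows "hemimorphic_frame.valid (crown_points m) crown_le N (crown_fm P n) \<longleftrightarrow> n \<noteq> m"
proof -
  interpret hemimorphic_frame "crown_points m" crown_le N by fact
  have BB: "eval v (Box P (Box P \<phi>)) = (if eval v \<phi> = X then X else {})"
    if "\<And>n. upset (v n)" for v \<phi>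
    unfolding box_box[OF upset_eval[OF that], symmetric]
    using that by (simp add: Box_def P box_def)
  let ?pre = "\<lambda>v. X \<subseteq> (\<Union>i<n. imp (v i) {}) \<and> (\<forall>i<n. \<forall>j<n. i \<noteq> j \<longrightarrow> v i \<inter> v j = {})"
  let ?con = "\<lambda>v. \<exists>i<n. v i = {}"
  have iff: "eval v (crown_fm P n) = X \<longleftrightarrow> (?pre v \<longrightarrow> ?con v)" if "\<And>n. upset (v n)" for v
  proof -
    let ?A = "\<Union>i<n. imp (v i) {}"
    let ?B = "\<Inter>(i, j)\<in>{(i, j). i < n \<and> j < n \<and> i \<noteq> j}. imp (v i \<inter> v j) {}"
    have star: "imp (v i) {} = X \<longleftrightarrow> v i = {}" for i
      using that by (simp add: imp_eq_X_iff)
    have "X \<subseteq> imp (v i \<inter> v j) {} \<longleftrightarrow> imp (v i \<inter> v j) {} = X" for i j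
      by (auto simp: imp_def)
    then have "X \<subseteq> imp (v i \<inter> v j) {} \<longleftrightarrow> v i \<inter> v j = {}" for i j
      using that by (simp add: imp_eq_X_iff upset_Int)
    then have "X \<subseteq> ?B \<longleftrightarrow> (\<forall>i<n. \<forall>j<n. i \<noteq> j \<longrightarrow> v i \<inter> v j = {})"
      by (simp add: le_INF_iff split: prod.splits) blast
    moreover have "A \<inter> (X \<inter> B) = X \<longleftrightarrow> X \<subseteq> A \<and> X \<subseteq> B" for A B
      by blast
    ultimately have pre: "?A \<inter> (X \<inter> ?B) = X \<longleftrightarrow> ?pre v"
      by (simp only:)
    have "X \<noteq> {}"
      using m_ge by (auto simp: crown_points_def lessThan_empty_iff)
    have pairs: "set (filter (\<lambda>(i, j). i \<noteq> j) (List.product [0..<n] [0..<n])) =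
        {(i, j). i < n \<and> j < n \<and> i \<noteq> j}"
      by auto
    have eval: "eval v (crown_fm P n) =
        imp (if ?A \<inter> (X \<inter> ?B) = X then X else {}) (\<Union>i<n. if imp (v i) {} = X then X else {})"
      unfolding crown_fm_def eval.simps BB[OF that] eval_Disj eval_Conj list.set_map pairs image_image
      by (simp add: BB that atLeast0LessThan split_beta)
    have con: "(\<Union>i<n. if imp (v i) {} = X then X else {}) = (if ?con v then X else {})"
      unfolding star by auto
    have "imp (if p then X else {}) (if q then X else {}) = X \<longleftrightarrow> (p \<longrightarrow> q)" for p q
      using \<open>X \<noteq> {}\<close> by (simp add: imp_eq_X_iff upset_X upset_empty)
    then show ?thesis
      unfolding eval con pre by (simp only:)
  qed
  show ?thesis
  proof
    assume "valid (crown_fm P n)"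
    show "n \<noteq> m"
    proof
      assume "n = m"
      \<comment> \<open>The singletons of tops are upsets because tops are maximal.\<close>
      define v where "v i = (if i < m then {(i, True)} else {})" for i :: nat
      have up: "upset (v i)" for i
        unfolding upset_def by (auto simp: v_def crown_points_def crown_le_def)
      have "(j, s) \<in> (\<Union>i<m. imp (v i) {})" if "j < m" for j s
      proof -
        obtain k where "k < m" "k \<noteq> j"
          using ex_other by blast
        \<comment> \<open>Top \<open>j\<close> avoids the singleton of another top \<open>k\<close>;
          bottom \<open>j\<close> is not below its own top.\<close>
        then show ?thesis
          using that
          by (intro UN_I[of "if s then k else j"]; simp add: mem_imp)
            (auto simp: v_def crown_points_def crown_le_def)
      qed
      then have "?pre v"
        using \<open>n = m\<close> by (auto simp: crown_points_def v_def)
      then show False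
        using \<open>valid (crown_fm P n)\<close> iff[of v] up \<open>n = m\<close> by (auto simp: valid_def v_def)
    qed
  next
    assume "n \<noteq> m"
    show "valid (crown_fm P n)"
      unfolding valid_def
    proof (intro allI impI)
      fix v :: "nat \<Rightarrow> (nat \<times> bool) set"
      assume up: "\<forall>k. upset (v k)"
      have "n = m" if "?pre v" "\<not> ?con v"
        by (rule crown_partition[of n v]) (use up that in auto)
      then have "?pre v \<longrightarrow> ?con v"
        using \<open>n \<noteq> m\<close> by blast
      then show "eval v (crown_fm P n) = X"
        using iff up by simp
    qed
  qed
qed

end

section \<open>The three logics\<close>

text \<open>The shift by 3 makes the crown that refutes the formula satisfy
  \<open>m_ge\<close>.\<close>

definition dp_fm :: "nat \<Rightarrow> fm" where
  "dp_fm k = crown_fm Neg (k + 3)"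

text \<open>In a De Morgan Heyting algebra the dual pseudocomplement of \<open>a\<close> is \<open>\<^bold>\<sim> ((\<^bold>\<sim> a)\<^sup>\<star>)\<close>.\<close>

definition dm_fm :: "nat \<Rightarrow> fm" where
  "dm_fm k = crown_fm (\<lambda>\<phi>. \<^bold>\<sim> ((\<^bold>\<sim> \<phi>)\<^sup>\<star>)) (k + 3)"

context crown
begin

lemma dp_valid_crown_fm_iff: "dp.valid (dp_fm k) \<longleftrightarrow> k + 3 \<noteq> m"
  unfolding dp_fm_def
  by (rule hemimorphic_crown_fm_valid_iff) (simp_all add: dp.hemimorphic_frame_axioms)

lemma dm_valid_crown_fm_iff: "dm.valid (dm_fm k) \<longleftrightarrow> k + 3 \<noteq> m"
  unfolding dm_fm_def
  by (rule hemimorphic_crown_fm_valid_iff)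
    (simp_all add: dm.hemimorphic_frame_axioms demorgan_imp_demorgan dm.upset_eval)

lemma dp_valid_axioms:
  assumes "\<phi> \<in> axioms RDPCH"
  shows "dp.valid \<phi>"
proof -
  have Un_dpc: "v 0 \<union> dpc (v 0) = X" if "\<forall>n. upset (v n)" for v :: "nat \<Rightarrow> _ set"
  proof -
    have "v 0 \<subseteq> X"
      using that by (simp add: upset_def)
    then show ?thesis
      using le_refl by (auto simp: dpc_def)
  qed
  have "dp.valid \<phi>" if "\<phi> \<notin> axioms DHMSH"
    using assms that unfolding RDPCH_def Let_def extend_def
    apply simp
    apply (elim disjE; hypsubst; (subst dp.valid_And_iff)?; (subst dp.valid_ImpH_iff)?; (subst dp.valid_ImpH_iff)?)
         apply (simp_all add: dp.valid_def imp_eq_X_iff upset_Int dp.N_empty Un_dpc dpc_dpc_Un dpc_dpc_subset)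
    \<comment> \<open>What is left is the regularity axiom, the last one of
      \<open>RDPCH\<close>.\<close>
    using regular by blast
  then show ?thesis
    using dp.valid_axioms_DHMSH by blast
qed

lemma dm_valid_axioms:
  assumes "\<phi> \<in> axioms RDMH"
  shows "dm.valid \<phi>"
proof -
  have "dm.valid \<phi>" if "\<phi> \<notin> axioms DHMSH"
    using assms that unfolding RDMH_def Let_def extend_def
    apply simp
    apply (elim disjE; hypsubst; (subst dm.valid_And_iff)?; (subst dm.valid_ImpH_iff)?; (subst dm.valid_ImpH_iff)?)
      apply (simp_all add: dm.valid_def imp_eq_X_iff upset_Int demorgan_demorgan demorgan_imp_demorgan)
    using regular by blast
  then show ?thesis
    using dm.valid_axioms_DHMSH by blast
qed

end

text \<open>The crown of size \<open>k + 3\<close> validates \<open>RDPCH\<close> and every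
  \<open>dp_fm j\<close> with \<open>j \<noteq> k\<close>, but refutes
  \<open>dp_fm k\<close>.\<close>

lemma dp_fm_independent:
  assumes "k \<notin> A"
  shows "\<not> derives (extend RDPCH (dp_fm ` A)) {} (dp_fm k)"
proof
  interpret crown "k + 3" by standard simp
  assume "derives (extend RDPCH (dp_fm ` A)) {} (dp_fm k)"
  then have "dp.valid (dp_fm k)"
  proof (rule dp.valid_if_derives)
    show "dp.valid \<psi>" if "\<psi> \<in> axioms (extend RDPCH (dp_fm ` A))" for \<psi>
      using that assms dp_valid_axioms dp_valid_crown_fm_iff by (auto simp: extend_def)
  qed (simp_all add: extend_def RDPCH_def Let_def DHMSH_def)
  then show False
    by (simp add: dp_valid_crown_fm_iff)
qed

lemma dm_fm_independent:
  assumes "k \<notin> A"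
  shows "\<not> derives (extend RDMH (dm_fm ` A)) {} (dm_fm k)"
proof
  interpret crown "k + 3" by standard simp
  assume "derives (extend RDMH (dm_fm ` A)) {} (dm_fm k)"
  then have "dm.valid (dm_fm k)"
  proof (rule dm.valid_if_derives)
    show "dm.valid \<psi>" if "\<psi> \<in> axioms (extend RDMH (dm_fm ` A))" for \<psi>
      using that assms dm_valid_axioms dm_valid_crown_fm_iff by (auto simp: extend_def)
  qed (simp_all add: extend_def RDMH_def Let_def DHMSH_def)
  then show False
    by (simp add: dm_valid_crown_fm_iff)
qed

section \<open>Transfer to the dual logic\<close>

primrec undual :: "dfm \<Rightarrow> fm" where
  "undual (DVar n) = Var n"
| "undual (DOr a b) = undual a \<^bold>\<and> undual b"
| "undual (DAnd a b) = undual a \<^bold>\<or> undual b"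
| "undual (DImp a b) = undual a \<^bold>\<rightarrow> undual b"
| "undual (DNeg a) = \<^bold>\<sim> undual a"
| "undual DBot = \<^bold>\<top>"
| "undual DTop = \<^bold>\<bottom>"

lemma undual_dual: "undual (dual \<phi>) = \<phi>"
  by (induction \<phi>) simp_all

lemma undual_subst_dual: "undual (subst_dfm \<sigma> (dual \<phi>)) = subst_fm (\<lambda>n. undual (\<sigma> n)) \<phi>"
  by (induction \<phi>) simp_all

lemma inst_RDPCH: "inst RDPCH = subst_fm"
  by (simp add: RDPCH_def DHMSH_def Let_def extend_def)

lemma inst_RDMH: "inst RDMH = subst_fm"
  by (simp add: RDMH_def DHMSH_def Let_def extend_def)

text \<open>Axioms and rules of \<open>RPCHd\<close> are images under \<open>dual\<close>, so their
  instances undualize to instances in \<open>RDPCH\<close> under the undualized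
  substitution.\<close>

lemma derives_undual:
  assumes "derives (extend RPCHd (dual ` E)) {} \<chi>"
  shows "derives (extend RDPCH E) {} (undual \<chi>)"
  using assms
proof (induction rule: derives.induct)
  case (premise \<phi>)
  then show ?case by simp
next
  case (axiom \<phi> \<sigma>)
  then obtain \<psi> where "\<phi> = dual \<psi>" "\<psi> \<in> axioms (extend RDPCH E)"
    by (auto simp: extend_def RPCHd_def)
  then show ?case
    using derives.axiom[of \<psi> "extend RDPCH E" "{}" "\<lambda>n. undual (\<sigma> n)"]
    by (simp add: extend_def RPCHd_def inst_RDPCH undual_subst_dual)
next
  case (rule ps c \<sigma>)
  then obtain qs d where qd: "ps = map dual qs" "c = dual d" "(qs, d) \<in> rules (extend RDPCH E)"
    by (auto simp: extend_def RPCHd_def)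
  have "\<forall>p\<in>set qs. derives (extend RDPCH E) {} (inst (extend RDPCH E) (\<lambda>n. undual (\<sigma> n)) p)"
    using rule.IH qd(1) by (auto simp: extend_def RPCHd_def inst_RDPCH undual_subst_dual)
  then show ?case
    using derives.rule[OF qd(3)] qd(2)
    by (simp add: extend_def RPCHd_def inst_RDPCH undual_subst_dual)
qed

lemma subst_fm_Var: "subst_fm Var \<phi> = \<phi>"
  by (induction \<phi>) simp_all

lemma subst_dfm_DVar: "subst_dfm DVar \<phi> = \<phi>"
  by (induction \<phi>) simp_all

theorem corollary3p15:
  "Ext RDPCH \<approx> (UNIV :: nat set set)
   \<and> Ext RPCHd \<approx> (UNIV :: nat set set)
   \<and> Ext RDMH \<approx> (UNIV :: nat set set)"
proof (intro conjI)
  show "Ext RDPCH \<approx> (UNIV :: nat set set)"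
    by (rule Ext_eqpoll_if_independent[where \<iota> = Var and f = dp_fm])
      (simp_all add: inst_RDPCH subst_fm_Var dp_fm_independent)
  show "Ext RDMH \<approx> (UNIV :: nat set set)"
    by (rule Ext_eqpoll_if_independent[where \<iota> = Var and f = dm_fm])
      (simp_all add: inst_RDMH subst_fm_Var dm_fm_independent)
  show "Ext RPCHd \<approx> (UNIV :: nat set set)"
  proof (rule Ext_eqpoll_if_independent[where \<iota> = DVar and f = "\<lambda>k. dual (dp_fm k)"])
    show "\<not> derives (extend RPCHd ((\<lambda>k. dual (dp_fm k)) ` A)) {} (dual (dp_fm k))"
      if "k \<notin> A" for k A
      using derives_undual[of "dp_fm ` A" "dual (dp_fm k)"] dp_fm_independent[OF that]
      by (auto simp: undual_dual image_image)
  qed (simp add: RPCHd_def subst_dfm_DVar)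
qed

end
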